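(* Consider the Vlasov-Poisson system $$\partial_t f+v\cdot\nabla_x f-\vec E\cdot\nabla_v f=0,\qquad \vec E=-\nabla_x\phi,\qquad -\Delta\phi=-\int_{\mathbf{R}^d}f\,dv+1,$$ in a periodic box in $x$. (i) ($d=2$) Assume $\mu\in C^1(\mathbf{R})\cap L^1(\mathbf{R}^+)$, $\mu\ge0$. If $$f_0(x,v)=\mu\big(\tfrac12|v|^2-\beta(x)\big),\qquad \vec E_0(x)=-\nabla\beta$$ is a (steady) solution of the Vlasov-Poisson system, then $\vec E_0\equiv0$. (ii) ($d=3$) Assume $\mu\in C^1(\mathbf{R}\times\mathbf{R})\cap L^1(\mathbf{R}^+\times\mathbf{R})$, $\mu\ge0$. If $$f_0(x_1,x_2,v_1,v_2,v_3)=\mu\big(\tfrac12(v_1^2+v_2^2)-\beta(x_1,x_2),\,v_3\big),\qquad \vec E_0(x_1,x_2)=(-\partial_{x_1}\beta,-\partial_{x_2}\beta,0)$$ is a (steady) solution of the Vlasov-Poisson system, then $\vec E_0\equiv0$. (iii) ($d=3$) Assume $\mu\in C^1(\mathbf{R})$, $\mu\ge0$, $\mu(r)\sqrt r\in L^1(\mathbf{R}^+)$. If $$f_0(x,v)=\mu\big(\tfrac12|v|^2-\beta(x)\big),\qquad \vec E_0(x)=-\nabla\beta$$ is a (steady) solution of the Vlasov-Poisson system, then $\vec E_0\equiv0$.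
   Context: The Vlasov-Poisson system is posed with periodic conditions in $x$ (period $T_i$ in $x_i$, $i=1,\dots,d$), $v\in\mathbf{R}^d$; in particular the electric potential $\beta$ is periodic in the space variables. Being a solution means in particular that the potential $\beta$ satisfies the Poisson equation $-\Delta\beta=-\int_{\mathbf{R}^d}f_0\,dv+1$. *)

theory Defs
  imports "HOL-Analysis.Analysis"
begin

definition partial_deriv :: "'n::finite \<Rightarrow> (real^'n \<Rightarrow> real) \<Rightarrow> real^'n \<Rightarrow> real" where
  "partial_deriv i g x = frechet_derivative g (at x) (axis i 1)"

definition gradient :: "(real^'n::finite \<Rightarrow> real) \<Rightarrow> real^'n \<Rightarrow> real^'n" where
  "gradient g x = (\<chi> i. partial_deriv i g x)"

definition laplacian :: "(real^'n::finite \<Rightarrow> real) \<Rightarrow> real^'n \<Rightarrow> real" where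
  "laplacian g x = (\<Sum>i\<in>UNIV. partial_deriv i (partial_deriv i g) x)"

definition twice_differentiable :: "(real^'n::finite \<Rightarrow> real) \<Rightarrow> bool" where
  "twice_differentiable g \<longleftrightarrow>
     (\<forall>x. g differentiable (at x)) \<and> (\<forall>i x. partial_deriv i g differentiable (at x))"

text \<open>Functions on the periodic box with side lengths \<open>T $ i\<close> are represented by
  functions on the whole space that are \<open>T $ i\<close>-periodic in the \<open>i\<close>-th coordinate.\<close>

definition box_periodic :: "real^'n::finite \<Rightarrow> (real^'n \<Rightarrow> 'b) \<Rightarrow> bool" where
  "box_periodic T g \<longleftrightarrow> (\<forall>i x. g (x + (T $ i) *\<^sub>R axis i 1) = g x)"

text \<open>Solutions are understood in the classical, pointwise sense. The differentiability
  clauses are needed because \<^const>\<open>frechet_derivative\<close> and \<^const>\<open>deriv\<close> are total functions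
  with arbitrary values where no derivative exists; likewise the integrability clause expresses
  that the density in the Poisson equation is finite, since the Bochner integral of a
  non-integrable function is 0 by convention.\<close>

definition vlasov_poisson ::
  "real^'n::finite \<Rightarrow> (real \<Rightarrow> real^'n \<Rightarrow> real^'n \<Rightarrow> real) \<Rightarrow> (real \<Rightarrow> real^'n \<Rightarrow> real^'n)
     \<Rightarrow> (real \<Rightarrow> real^'n \<Rightarrow> real) \<Rightarrow> bool" where
  "vlasov_poisson T f E \<phi> \<longleftrightarrow>
     (\<forall>t v. box_periodic T (\<lambda>x. f t x v)) \<and>
     (\<forall>t. box_periodic T (\<phi> t)) \<and>
     (\<forall>t x v. (\<lambda>s. f s x v) differentiable (at t)) \<and>
     (\<forall>t x v. (\<lambda>y. f t y v) differentiable (at x)) \<and>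
     (\<forall>t x v. f t x differentiable (at v)) \<and>
     (\<forall>t. twice_differentiable (\<phi> t)) \<and>
     (\<forall>t x. integrable lborel (f t x)) \<and>
     (\<forall>t x v. deriv (\<lambda>s. f s x v) t + v \<bullet> gradient (\<lambda>y. f t y v) x
                - E t x \<bullet> gradient (f t x) v = 0) \<and>
     (\<forall>t x. E t x = - gradient (\<phi> t) x) \<and>
     (\<forall>t x. - laplacian (\<phi> t) x = - integral\<^sup>L lborel (f t x) + 1)"

definition steady_vlasov_poisson ::
  "real^'n::finite \<Rightarrow> (real^'n \<Rightarrow> real^'n \<Rightarrow> real) \<Rightarrow> (real^'n \<Rightarrow> real^'n)
     \<Rightarrow> (real^'n \<Rightarrow> real) \<Rightarrow> bool" where
  "steady_vlasov_poisson T f E \<phi> \<longleftrightarrow> vlasov_poisson T (\<lambda>_. f) (\<lambda>_. E) (\<lambda>_. \<phi>)"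

definition C1_on_plane :: "(real \<times> real \<Rightarrow> real) \<Rightarrow> bool" where
  "C1_on_plane \<mu> \<longleftrightarrow> (\<exists>D. (\<forall>p. GDERIV \<mu> p :> D p) \<and> continuous_on UNIV D)"

end

theory Submission
  imports Defs
begin

text \<open>Both sides of the Poisson equation \<open>\<Delta>\<beta> = \<rho> - 1\<close> are compared at two points. Since the
  energy \<open>|v|\<^sup>2 / 2\<close> has a nondecreasing density with respect to Lebesgue measure in dimension
  \<open>d \<ge> 2\<close>, the charge \<open>\<rho>\<close> is a nondecreasing function of the value of \<open>\<beta>\<close>
  (for the cylindrical profiles this is applied in the plane for each fixed \<open>v\<^sub>3\<close>). So it suffices to show
  that a periodic function whose Laplacian is a nondecreasing function of its value is constant.
  To this end \<open>\<beta> (x + t e\<^sub>i) - \<beta> x - \<epsilon> ln (1 + t)\<close> is maximised over \<open>x\<close> and \<open>t \<ge> 0\<close>: at a positive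
  maximum the second-derivative test would yield \<open>\<Delta>\<beta> (x + t e\<^sub>i) < \<Delta>\<beta> x\<close> although
  \<open>\<beta> (x + t e\<^sub>i) > \<beta> x\<close>. Letting \<open>\<epsilon> \<rightarrow> 0\<close>, \<open>\<beta>\<close> is nonincreasing along each axis, hence constant. This
  only needs the pointwise existence of second derivatives, so that no integration by parts over the
  box (which would require integrability of the second derivatives) is involved.\<close>

section \<open>One-variable calculus along coordinate lines\<close>

text \<open>Fermat's theorem gives \<open>h' 0 = 0\<close>. If \<open>D\<close> were positive,
  \<open>h'\<close> would be positive just to the right of 0, and the mean value theorem would push
  \<open>h\<close> above \<open>h 0\<close> there.\<close>

lemma DERIV_second_local_max_le:
  fixes h h' :: "real \<Rightarrow> real"
  assumes "0 < d"
    and h: "\<And>s. \<bar>s\<bar> < d \<Longrightarrow> (h has_real_derivative h' s) (at s)"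
    and D: "(h' has_real_derivative D) (at 0)"
    and max: "\<And>s. \<bar>s\<bar> < d \<Longrightarrow> h s \<le> h 0"
  shows "D \<le> 0"
proof (rule ccontr)
  assume "\<not> D \<le> 0"
  have h0: "h' 0 = 0"
    using DERIV_local_max[OF h[of 0] \<open>0 < d\<close>] max \<open>0 < d\<close> by auto
  obtain e where e: "e > 0" "\<And>s. s > 0 \<Longrightarrow> s < e \<Longrightarrow> h' 0 < h' (0 + s)"
    using DERIV_pos_inc_right[OF D] \<open>\<not> D \<le> 0\<close> by (meson not_le)
  define s where "s = min d e / 2"
  have s: "0 < s" "s < d" "s < e"
    using e(1) \<open>0 < d\<close> by (auto simp: s_def min_def)
  have "\<exists>z>0. z < s \<and> h s - h 0 = (s - 0) * h' z"
    by (rule MVT2) (use s in \<open>auto intro!: h\<close>)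
  then obtain z where z: "0 < z" "z < s" "h s - h 0 = s * h' z"
    by auto
  have "h' z > 0"
    using e(2)[of z] z s h0 by simp
  then have "h s > h 0"
    using z(3) mult_pos_pos[OF s(1)] by fastforce
  with max[of s] s show False by simp
qed

text \<open>Chain rule. The speed \<open>c\<close> allows the maximum argument to run backwards
  along the axis, with \<open>c = -1\<close>.\<close>

lemma has_real_derivative_along_axis:
  fixes g :: "real^'n::finite \<Rightarrow> real"
  assumes "\<And>x. g differentiable (at x)"
  shows "((\<lambda>s. g (x + (c * s) *\<^sub>R axis i 1)) has_real_derivative
            c * partial_deriv i g (x + (c * s) *\<^sub>R axis i 1)) (at s)"
proof -
  let ?y = "x + (c * s) *\<^sub>R axis i 1"
  have g: "(g has_derivative frechet_derivative g (at ?y)) (at ?y)"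
    using assms frechet_derivative_works by blast
  have "((\<lambda>s. x + (c * s) *\<^sub>R axis i 1) has_derivative (\<lambda>r. (c * r) *\<^sub>R axis i (1::real))) (at s)"
    by (auto intro!: derivative_eq_intros)
  from diff_chain_at[OF this g]
  have "((\<lambda>s. g (x + (c * s) *\<^sub>R axis i 1)) has_derivative
      (\<lambda>r. frechet_derivative g (at ?y) ((c * r) *\<^sub>R axis i 1))) (at s)"
    by (simp add: o_def)
  also have "(\<lambda>r. frechet_derivative g (at ?y) ((c * r) *\<^sub>R axis i 1)) =
      (*) (c * partial_deriv i g ?y)"
    using linear_scale[OF has_derivative_linear[OF g]]
    by (auto simp: partial_deriv_def fun_eq_iff)
  finally show ?thesis
    by (simp add: has_field_derivative_def)
qed

section \<open>Periodicity and reduction to the period box\<close>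

lemma box_periodic_int:
  fixes T :: "real^'n::finite"
  assumes "box_periodic T u"
  shows "u (x + (of_int k * T $ i) *\<^sub>R axis i 1) = u x"
proof -
  have step: "u (y + (T $ i) *\<^sub>R axis i 1) = u y" for y
    using assms by (simp add: box_periodic_def)
  have nat: "u (y + (of_nat n * T $ i) *\<^sub>R axis i 1) = u y" for n y
  proof (induction n)
    case (Suc n)
    show ?case
      using step[of "y + (of_nat n * T $ i) *\<^sub>R axis i 1"] Suc
      by (simp add: algebra_simps)
  qed simp
  show ?thesis
  proof (cases k rule: int_cases2)
    case (nonneg n)
    then show ?thesis using nat by simp
  next
    case (nonpos n)
    \<comment> \<open>A backward shift is undone by moving \<open>n\<close> periods forward from the
      translated point to \<open>x\<close>.\<close>
    then show ?thesis
      using nat[of "x + (of_int k * T $ i) *\<^sub>R axis i 1" n] by simp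
  qed
qed

text \<open>Shifting back by the floor of \<open>x $ i / T $ i\<close> periods in every coordinate
  lands in the box. The offset \<open>z\<close> is universally quantified so that a point and its
  translate along an axis are reduced by one and the same shift.\<close>

lemma box_periodic_reduce:
  fixes T :: "real^'n::finite"
  assumes "box_periodic T u" and pos: "\<And>i. T $ i > 0"
  obtains y where "y \<in> cbox 0 T" "\<And>z. u (y + z) = u (x + z)"
proof -
  define k where "k i = - \<lfloor>x $ i / T $ i\<rfloor>" for i
  define p where "p I = (\<Sum>i\<in>I. (of_int (k i) * T $ i) *\<^sub>R axis i (1::real))" for I
  have shift: "u (z + p I) = u z" if "finite I" for z I
    using that
  proof (induction I arbitrary: z)
    case (insert i I)
    then have "u (z + p (insert i I)) = u ((z + p I) + (of_int (k i) * T $ i) *\<^sub>R axis i (1::real))"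
      by (simp add: p_def algebra_simps)
    also have "\<dots> = u z"
      using box_periodic_int[OF assms(1)] insert by simp
    finally show ?case .
  qed (simp add: p_def)
  have comp: "(x + p UNIV) $ i = x $ i - of_int \<lfloor>x $ i / T $ i\<rfloor> * T $ i" for i
    by (simp add: p_def k_def axis_def if_distrib sum.delta cong: if_cong)
  have "0 \<le> (x + p UNIV) $ i \<and> (x + p UNIV) $ i \<le> T $ i" for i
  proof -
    have "of_int \<lfloor>x $ i / T $ i\<rfloor> * T $ i \<le> x $ i"
      using pos[of i] of_int_floor_le by (simp add: pos_le_divide_eq[symmetric])
    moreover have "x $ i < (of_int \<lfloor>x $ i / T $ i\<rfloor> + 1) * T $ i"
      using pos[of i] by (simp add: pos_divide_less_eq[symmetric])
    ultimately show ?thesis unfolding comp by (simp add: algebra_simps)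
  qed
  then have "x + p UNIV \<in> cbox 0 T"
    by (simp add: mem_box_cart)
  moreover have "u ((x + p UNIV) + z) = u (x + z)" for z
    using shift[of UNIV "x + z"] by (simp add: algebra_simps)
  ultimately show ?thesis by (rule that)
qed

lemma box_periodic_continuous_bounded:
  fixes T :: "real^'n::finite" and u :: "real^'n \<Rightarrow> real"
  assumes per: "box_periodic T u" and pos: "\<And>i. T $ i > 0" and cont: "continuous_on UNIV u"
  obtains M where "\<And>x. \<bar>u x\<bar> \<le> M"
proof -
  have "compact (u ` cbox 0 T)"
    by (intro compact_continuous_image compact_cbox continuous_on_subset[OF cont]) auto
  then obtain M where M: "\<And>y. y \<in> cbox 0 T \<Longrightarrow> \<bar>u y\<bar> \<le> M"
    by (meson bounded_real compact_imp_bounded imageI)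
  have "\<bar>u x\<bar> \<le> M" for x
  proof -
    obtain y where "y \<in> cbox 0 T" "\<And>z. u (y + z) = u (x + z)"
      by (rule box_periodic_reduce[OF per pos, of x]) blast
    then show ?thesis using M[of y] by (metis add.right_neutral)
  qed
  then show ?thesis by (rule that)
qed

section \<open>Maximum principle for increments along an axis\<close>

text \<open>Moving \<open>x\<close> and \<open>x + t e\<^sub>i\<close> together in the directions \<open>e\<^sub>j\<close>, \<open>j \<noteq> i\<close>, but oppositely in the
  direction \<open>e\<^sub>i\<close>, the second derivatives at a maximum of \<open>u (x + t e\<^sub>i) - u x - \<epsilon> ln (1 + t)\<close>
  add up to a difference of Laplacians plus \<open>4 \<epsilon> / (1 + t)\<^sup>2 > 0\<close>.\<close>

lemma laplacian_less_at_max: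
  fixes u :: "real^'n::finite \<Rightarrow> real"
  assumes u: "twice_differentiable u" and "\<epsilon> > 0" and "t > 0"
    and max: "\<And>y s. s \<ge> 0 \<Longrightarrow> u (y + s *\<^sub>R axis i 1) - u y - \<epsilon> * ln (1 + s)
                 \<le> u (x + t *\<^sub>R axis i 1) - u x - \<epsilon> * ln (1 + t)"
  shows "laplacian u (x + t *\<^sub>R axis i 1) < laplacian u x"
proof -
  define X where "X = x + t *\<^sub>R axis i 1"
  let ?D = "\<lambda>j. partial_deriv j (partial_deriv j u)"
  have d1: "\<And>x. u differentiable (at x)" and d2: "\<And>j x. partial_deriv j u differentiable (at x)"
    using u by (auto simp: twice_differentiable_def)
  have other: "?D j X - ?D j x \<le> 0" for j
  proof (rule DERIV_second_local_max_le[of 1])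
    let ?h = "\<lambda>s. u (X + (1 * s) *\<^sub>R axis j 1) - u (x + (1 * s) *\<^sub>R axis j 1)"
    let ?h' = "\<lambda>s. 1 * partial_deriv j u (X + (1 * s) *\<^sub>R axis j 1) -
                    1 * partial_deriv j u (x + (1 * s) *\<^sub>R axis j 1)"
    show "(?h has_real_derivative ?h' s) (at s)" for s
      by (intro DERIV_diff has_real_derivative_along_axis d1)
    show "(?h' has_real_derivative ?D j X - ?D j x) (at 0)"
      using DERIV_diff[OF has_real_derivative_along_axis[OF d2[of j], where x = X and c = 1 and i = j and s = 0]
          has_real_derivative_along_axis[OF d2[of j], where x = x and c = 1 and i = j and s = 0]] by simp
    show "?h s \<le> ?h 0" for s
      using max[of t "x + s *\<^sub>R axis j 1"] \<open>t > 0\<close> by (simp add: X_def algebra_simps)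
  qed simp
  have "?D i X - ?D i x + 4 * \<epsilon> / (1 + t)\<^sup>2 \<le> 0"
  \<comment> \<open>The two points move apart at speed 2. For \<open>\<bar>s\<bar> < t / 2\<close>
    their separation \<open>t + 2 * s\<close> stays positive, so \<open>max\<close> still applies
    and the logarithm is smooth.\<close>
  proof (rule DERIV_second_local_max_le[of "t / 2"])
    let ?h = "\<lambda>s. u (X + (1 * s) *\<^sub>R axis i 1) - u (x + (-1 * s) *\<^sub>R axis i 1)
                    - \<epsilon> * ln (1 + t + 2 * s)"
    let ?h' = "\<lambda>s. 1 * partial_deriv i u (X + (1 * s) *\<^sub>R axis i 1) -
                    -1 * partial_deriv i u (x + (-1 * s) *\<^sub>R axis i 1) - 2 * \<epsilon> / (1 + t + 2 * s)"
    show "(?h has_real_derivative ?h' s) (at s)" if "\<bar>s\<bar> < t / 2" for s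
    proof (intro DERIV_diff has_real_derivative_along_axis d1)
      show "((\<lambda>s. \<epsilon> * ln (1 + t + 2 * s)) has_real_derivative 2 * \<epsilon> / (1 + t + 2 * s)) (at s)"
        using that \<open>t > 0\<close> by (auto intro!: derivative_eq_intros)
    qed
    have ln: "((\<lambda>s. 2 * \<epsilon> / (1 + t + 2 * s)) has_real_derivative - 4 * \<epsilon> / (1 + t)\<^sup>2) (at 0)"
      using \<open>t > 0\<close> by (auto intro!: derivative_eq_intros simp: power2_eq_square)
    show "(?h' has_real_derivative ?D i X - ?D i x + 4 * \<epsilon> / (1 + t)\<^sup>2) (at 0)"
      using DERIV_diff[OF DERIV_diff[
            OF has_real_derivative_along_axis[OF d2[of i], where x = X and c = 1 and i = i and s = 0]
            DERIV_cmult[OF has_real_derivative_along_axis[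
                OF d2[of i], where x = x and c = "-1" and i = i and s = 0], of "-1"]] ln]
      by simp
    show "?h s \<le> ?h 0" if "\<bar>s\<bar> < t / 2" for s
    proof -
      have shift: "(x - s *\<^sub>R axis i 1) + (t + 2 * s) *\<^sub>R axis i 1 = X + s *\<^sub>R axis i 1"
        unfolding X_def mult_2 scaleR_add_left by (simp only: diff_conv_add_uminus ac_simps) simp
      show ?thesis
        using max[of "t + 2 * s" "x - s *\<^sub>R axis i 1", unfolded shift] that
        by (simp add: X_def[symmetric] add.assoc)
    qed
  qed (use \<open>t > 0\<close> in simp)
  moreover have "4 * \<epsilon> / (1 + t)\<^sup>2 > 0"
    using \<open>\<epsilon> > 0\<close> \<open>t > 0\<close> by simp
  ultimately have "?D i X < ?D i x" by linarith
  then have "laplacian u X < laplacian u x"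
    unfolding laplacian_def using other by (intro sum_strict_mono_ex1) auto
  then show ?thesis by (simp add: X_def)
qed

text \<open>Periodicity confines the base point to a compact box and the unbounded logarithmic
  penalty confines the increment length. So a positive value of the penalised increment yields a
  maximum to which \<open>laplacian_less_at_max\<close> applies, against
  \<open>mono\<close>.\<close>

lemma box_periodic_laplacian_mono_imp_le:
  fixes T :: "real^'n::finite"
  assumes per: "box_periodic T u" and pos: "\<And>i. T $ i > 0"
    and u: "twice_differentiable u"
    and mono: "\<And>x y. u x < u y \<Longrightarrow> laplacian u x \<le> laplacian u y"
    and "t \<ge> 0"
  shows "u (x + t *\<^sub>R axis i 1) \<le> u x"
proof -
  have cont: "continuous_on UNIV u"
    using u by (auto simp: twice_differentiable_def differentiable_imp_continuous_within
        intro!: continuous_at_imp_continuous_on)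
  obtain M where M: "\<And>x. \<bar>u x\<bar> \<le> M"
    by (rule box_periodic_continuous_bounded[OF per pos cont]) blast
  define w where "w \<epsilon> p = u (fst p + snd p *\<^sub>R axis i 1) - u (fst p) - \<epsilon> * ln (1 + snd p)" for \<epsilon> p
  have le: "w \<epsilon> (x, t) \<le> 0" if "\<epsilon> > 0" for \<epsilon>
  proof (rule ccontr)
    assume neg: "\<not> w \<epsilon> (x, t) \<le> 0"
    \<comment> \<open>From \<open>R\<close> on the penalty is at least \<open>2 * M\<close>, which
      bounds every increment of \<open>u\<close>.\<close>
    define R where "R = exp (2 * M / \<epsilon>)"
    have far: "w \<epsilon> (y, s) \<le> 0" if "s \<ge> R" for y s
    proof -
      have "R > 0" by (simp add: R_def)
      then have "2 * M / \<epsilon> \<le> ln (1 + s)"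
        using that \<open>R > 0\<close> by (subst ln_ge_iff) (simp_all add: R_def[symmetric])
      then have "2 * M \<le> \<epsilon> * ln (1 + s)"
        using \<open>\<epsilon> > 0\<close> by (simp add: field_simps)
      then show ?thesis
        using M[of y] M[of "y + s *\<^sub>R axis i 1"] by (simp add: w_def)
    qed
    let ?K = "cbox 0 T \<times> {0..R}"
    have "continuous_on ?K (w \<epsilon>)"
      unfolding w_def
      by (intro continuous_intros continuous_on_compose2[OF cont]) auto
    moreover have "compact ?K" by (intro compact_Times) auto
    moreover have "?K \<noteq> {}"
    proof -
      have "0 \<in> cbox 0 T"
        unfolding mem_box_cart using pos[THEN less_imp_le] by simp
      moreover have "0 \<in> {0..R}" by (simp add: R_def)
      ultimately show ?thesis by blast
    qed
    ultimately have "\<exists>p\<in>?K. \<forall>q\<in>?K. w \<epsilon> q \<le> w \<epsilon> p"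
      by (intro continuous_attains_sup)
    then obtain p where p: "p \<in> ?K" "\<And>q. q \<in> ?K \<Longrightarrow> w \<epsilon> q \<le> w \<epsilon> p"
      by blast
    have near: "w \<epsilon> (y, s) \<le> w \<epsilon> p" if "0 \<le> s" "s \<le> R" for y s
    proof -
      obtain z where z: "z \<in> cbox 0 T" "\<And>a. u (z + a) = u (y + a)"
        by (rule box_periodic_reduce[OF per pos, of y]) blast
      have "w \<epsilon> (y, s) = w \<epsilon> (z, s)"
        using z(2)[of 0] z(2) by (simp add: w_def)
      then show ?thesis using p(2)[of "(z, s)"] z(1) that by simp
    qed
    \<comment> \<open>A positive value cannot occur beyond \<open>R\<close>, so
      \<open>(x, t)\<close> falls under \<open>near\<close>. Being positive,
      \<open>w \<epsilon> p\<close> then also dominates the values beyond \<open>R\<close>.\<close>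
    have wp: "w \<epsilon> p > 0"
      using near[of t x] far[of t x] neg \<open>t \<ge> 0\<close> by linarith
    have all: "w \<epsilon> (y, s) \<le> w \<epsilon> p" if "0 \<le> s" for y s
      using near[of s y] far[of s y] wp that by linarith
    obtain a r where ar: "p = (a, r)" by (cases p)
    have "r \<ge> 0" using p(1) ar by simp
    moreover have "r \<noteq> 0" using wp by (auto simp: ar w_def)
    ultimately have "r > 0" by simp
    have "laplacian u (a + r *\<^sub>R axis i 1) < laplacian u a"
      by (rule laplacian_less_at_max[OF u \<open>\<epsilon> > 0\<close> \<open>r > 0\<close>]) (use all in \<open>simp add: w_def ar\<close>)
    moreover have "u a < u (a + r *\<^sub>R axis i 1)"
    proof -
      have "\<epsilon> * ln (1 + r) > 0" using \<open>r > 0\<close> \<open>\<epsilon> > 0\<close> by simp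
      then show ?thesis using wp by (simp add: w_def ar)
    qed
    ultimately show False using mono by fastforce
  qed
  have "u (x + t *\<^sub>R axis i 1) - u x \<le> 0 + e" if "e > 0" for e
  proof -
    \<comment> \<open>The summand 1 keeps the denominator positive at \<open>t = 0\<close>, where
      the logarithm vanishes.\<close>
    define \<epsilon> where "\<epsilon> = e / (1 + ln (1 + t))"
    have ln: "ln (1 + t) \<ge> 0" using \<open>t \<ge> 0\<close> by simp
    then have "\<epsilon> > 0" using that by (simp add: \<epsilon>_def)
    moreover have "\<epsilon> * ln (1 + t) \<le> e" using that ln by (simp add: \<epsilon>_def field_simps)
    ultimately show ?thesis using le[of \<epsilon>] by (simp add: w_def)
  qed
  then have "u (x + t *\<^sub>R axis i 1) - u x \<le> 0"
    by (rule field_le_epsilon)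
  then show ?thesis by simp
qed

lemma box_periodic_laplacian_mono_imp_gradient_0:
  fixes T :: "real^'n::finite"
  assumes per: "box_periodic T u" and pos: "\<And>i. T $ i > 0"
    and u: "twice_differentiable u"
    and mono: "\<And>x y. u x < u y \<Longrightarrow> laplacian u x \<le> laplacian u y"
  shows "gradient u x = 0"
proof -
  have le: "u (x + t *\<^sub>R axis i 1) \<le> u x" if "t \<ge> 0" for x t i
    by (rule box_periodic_laplacian_mono_imp_le[OF per pos u _ that]) (rule mono)
  have eq: "u (x + t *\<^sub>R axis i 1) = u x" if "t \<ge> 0" for t i
  proof (rule antisym)
    obtain n :: nat where n: "t / T $ i \<le> real n" using real_arch_simple by blast
    then have n: "t \<le> real n * T $ i" using pos[of i] by (simp add: field_simps)
    then have rest: "real n * T $ i - t \<ge> 0"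
      by (rule diff_ge_0_iff_ge[THEN iffD2])
    \<comment> \<open>Periodicity closes the loop: the point \<open>n\<close> periods ahead carries
      the value \<open>u x\<close> and lies forward of \<open>x + t *\<^sub>R axis i 1\<close>, and
      \<open>u\<close> cannot increase on the way there.\<close>
    have "u x = u (x + (of_int (int n) * T $ i) *\<^sub>R axis i 1)"
      using box_periodic_int[OF per, of x "int n" i] by simp
    also have "\<dots> = u ((x + t *\<^sub>R axis i 1) + (real n * T $ i - t) *\<^sub>R axis i 1)"
      by (simp add: algebra_simps)
    also have "\<dots> \<le> u (x + t *\<^sub>R axis i 1)"
      by (rule le[OF rest])
    finally show "u x \<le> u (x + t *\<^sub>R axis i 1)" .
  qed (rule le[OF that])
  have "partial_deriv i u x = 0" for i
  proof -
    let ?h = "\<lambda>s. u (x + s *\<^sub>R axis i 1)"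
    have "(?h has_real_derivative partial_deriv i u x) (at 0)"
      using has_real_derivative_along_axis[of u x 1 i 0] u by (simp add: twice_differentiable_def)
    \<comment> \<open>Constancy is available for nonnegative \<open>s\<close>, so the derivative is
      identified as a limit from the right.\<close>
    then have 1: "(?h has_real_derivative partial_deriv i u x) (at 0 within {0..})"
      by (rule has_field_derivative_at_within)
    have 2: "(?h has_real_derivative 0) (at 0 within {0..})"
      by (rule has_field_derivative_transform_within[OF DERIV_const, of 1]) (auto simp: eq)
    have "at (0::real) within {0..} \<noteq> bot"
      by (simp add: at_within_Ici_at_right)
    from tendsto_unique[OF this 1[unfolded has_field_derivative_iff] 2[unfolded has_field_derivative_iff]]
    show ?thesis .
  qed
  then show ?thesis by (simp add: gradient_def vec_eq_iff)
qed

section \<open>Distribution of the kinetic energy in velocity space\<close>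

text \<open>Energy below \<open>s\<close> means lying in the ball of radius
  \<open>sqrt (2 * s)\<close>. The density is the derivative of its volume with respect to
  \<open>s\<close>, which explains \<open>C\<close>. The two measures are compared on half-lines
  \<open>{..<s}\<close>, an intersection-stable generator of the Borel sets.\<close>

lemma distr_lborel_norm_sq_half:
  fixes C :: real
  defines "C \<equiv> unit_ball_vol DIM('a) * 2 powr (DIM('a) / 2) * (DIM('a) / 2)"
  shows "distr lborel borel (\<lambda>v::'a::euclidean_space. (norm v)\<^sup>2 / 2) =
    density lborel (\<lambda>r. ennreal (indicator {0..} r * (C * r powr (DIM('a) / 2 - 1))))"
    (is "?M = ?N")
proof (rule measure_eqI_generator_eq)
  let ?d = "real DIM('a)"
  let ?w = "\<lambda>r. C * r powr (?d / 2 - 1)"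
  have d: "?d > 0" by simp
  have C: "C \<ge> 0" by (simp add: C_def)
  have M: "emeasure ?M {..<s} = ennreal (unit_ball_vol ?d * (2 * s) powr (?d / 2))" if "s > 0" for s
  proof -
    have "(\<lambda>v::'a. (norm v)\<^sup>2 / 2) -` {..<s} = ball 0 (sqrt (2 * s))"
    proof -
      have "(norm v)\<^sup>2 / 2 < s \<longleftrightarrow> norm v < sqrt (2 * s)" for v :: 'a
        using real_sqrt_less_iff[of "(norm v)\<^sup>2" "2 * s"] by auto
      then show ?thesis by auto
    qed
    moreover have "sqrt (2 * s) ^ DIM('a) = (2 * s) powr (?d / 2)"
      using that by (simp add: powr_half_sqrt[symmetric] powr_powr flip: powr_realpow)
    ultimately show ?thesis
      using that by (simp add: emeasure_distr emeasure_ball)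
  qed
  have N: "emeasure ?N {..<s} = ennreal (unit_ball_vol ?d * (2 * s) powr (?d / 2))" if "s > 0" for s
  proof -
    \<comment> \<open>This makes the power integrable at 0; in dimension one the exponent is
      negative.\<close>
    have "?d / 2 - 1 > -1" using d by linarith
    from has_integral_mult_right[OF has_integral_powr_from_0[OF this, of s], of C]
    have "(?w has_integral C * (s powr (?d / 2) / (?d / 2))) {0..s}"
      using that by simp
    also have "C * (s powr (?d / 2) / (?d / 2)) = unit_ball_vol ?d * (2 * s) powr (?d / 2)"
      using that by (simp add: C_def powr_mult)
    finally have I: "(?w has_integral unit_ball_vol ?d * (2 * s) powr (?d / 2)) {0..s}" .
    have "emeasure ?N {..<s} =
        (\<integral>\<^sup>+r. ennreal (indicator {0..} r * ?w r) * indicator {..<s} r \<partial>lborel)"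
      by (simp add: emeasure_density)
    \<comment> \<open>Adding the null set \<open>{s}\<close> gives the closed interval on which
      \<open>I\<close> is stated.\<close>
    also have "\<dots> = (\<integral>\<^sup>+r. ennreal (indicator {0..s} r * ?w r) \<partial>lborel)"
      by (intro nn_integral_cong_AE eventually_mono[OF AE_lborel_singleton[of s]])
        (auto simp: indicator_def)
    also have "\<dots> = ennreal (unit_ball_vol ?d * (2 * s) powr (?d / 2))"
      by (rule nn_integral_has_integral_lebesgue[OF _ I]) (use C in auto)
    finally show ?thesis .
  qed
  show "Int_stable (range (lessThan :: real \<Rightarrow> _))"
  proof (rule Int_stableI)
    fix A B assume "A \<in> range (lessThan :: real \<Rightarrow> _)" "B \<in> range (lessThan :: real \<Rightarrow> _)"
    then obtain a b where "A = {..<a}" "B = {..<b}" by auto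
    then have "A \<inter> B = {..<min a b}" by auto
    then show "A \<inter> B \<in> range lessThan" by simp
  qed
  show "sets ?M = sigma_sets UNIV (range lessThan)" "sets ?N = sigma_sets UNIV (range lessThan)"
    by (simp_all add: borel_Iio)
  \<comment> \<open>The offset 1 makes every endpoint positive, so that \<open>M\<close> gives
    finite measure.\<close>
  show "(\<Union>i::nat. {..<real i + 1}) = UNIV"
  proof -
    have "\<exists>i::nat. x < real i + 1" for x
      by (meson less_add_one order_le_less_trans real_arch_simple)
    then show ?thesis by auto
  qed
  show "emeasure ?M {..<real i + 1} \<noteq> \<infinity>" for i :: nat
    using M[of "real i + 1"] by simp
  show "emeasure ?M X = emeasure ?N X" if "X \<in> range lessThan" for X
  proof -
    obtain s where X: "X = {..<s}" using \<open>X \<in> range lessThan\<close> by (rule rangeE)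
    show ?thesis
    proof (cases "s > 0")
      case True
      then show ?thesis by (simp add: X M N)
    next
      \<comment> \<open>Energies are nonnegative and the density vanishes on negative reals, so both
        measures are 0 here.\<close>
      case False
      then have "s \<le> (norm v)\<^sup>2 / 2" for v :: 'a
        by (rule order_trans[OF leI]) simp
      then have "(\<lambda>v::'a. (norm v)\<^sup>2 / 2) -` {..<s} = {}"
        unfolding vimage_def lessThan_iff not_less[symmetric] by blast
      moreover have "emeasure ?N X = (\<integral>\<^sup>+r. 0 \<partial>(lborel :: real measure))"
        unfolding X using False
        by (subst emeasure_density)
          (auto simp: indicator_def simp del: nn_integral_const intro!: nn_integral_cong split: if_splits)
      ultimately show ?thesis by (simp add: X emeasure_distr)
    qed
  qed
qed auto

text \<open>In the energy variable, translated by \<open>b\<close>, the integral is that of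
  \<open>h r\<close> with weight \<open>w (r + b)\<close>, so \<open>b\<close> enters through the
  weight alone. The weight is nondecreasing: it is 0 on negative reals, and the exponent
  \<open>d / 2 - 1\<close> is nonnegative for \<open>d \<ge> 2\<close>.\<close>

lemma nn_integral_norm_sq_half_mono:
  fixes h :: "real \<Rightarrow> ennreal"
  assumes d: "DIM('a::euclidean_space) \<ge> 2"
    and h[measurable]: "h \<in> borel_measurable borel" and "b \<le> c"
  shows "(\<integral>\<^sup>+(v::'a). h ((norm v)\<^sup>2 / 2 - b) \<partial>lborel) \<le> (\<integral>\<^sup>+(v::'a). h ((norm v)\<^sup>2 / 2 - c) \<partial>lborel)"
proof -
  let ?d = "real DIM('a)"
  define C where "C = unit_ball_vol ?d * 2 powr (?d / 2) * (?d / 2)"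
  define w where "w r = indicator {0..} r * (C * r powr (?d / 2 - 1))" for r
  have C: "C \<ge> 0" by (simp add: C_def)
  have [measurable]: "w \<in> borel_measurable borel" unfolding w_def by measurable
  have eq: "(\<integral>\<^sup>+(v::'a). h ((norm v)\<^sup>2 / 2 - b) \<partial>lborel) = (\<integral>\<^sup>+r. ennreal (w (r + b)) * h r \<partial>lborel)" for b
  proof -
    have "(\<integral>\<^sup>+(v::'a). h ((norm v)\<^sup>2 / 2 - b) \<partial>lborel) =
        (\<integral>\<^sup>+r. h (r - b) \<partial>distr lborel borel (\<lambda>v::'a. (norm v)\<^sup>2 / 2))"
      by (simp add: nn_integral_distr)
    also have "\<dots> = (\<integral>\<^sup>+r. ennreal (w r) * h (r - b) \<partial>lborel)"
      unfolding distr_lborel_norm_sq_half w_def C_def by (simp add: nn_integral_density)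
    also have "\<dots> = (\<integral>\<^sup>+r. ennreal (w (r + b)) * h r \<partial>lborel)"
      by (subst nn_integral_real_affine[where c = 1 and t = b]) (simp_all add: add.commute)
    finally show ?thesis .
  qed
  have "w (r + b) \<le> w (r + c)" for r
    using d C \<open>b \<le> c\<close>
    by (auto simp: w_def indicator_def intro!: mult_left_mono powr_mono2)
  then show ?thesis
    unfolding eq by (intro nn_integral_mono mult_right_mono ennreal_leI) auto
qed

section \<open>Splitting three-dimensional velocity space into a plane and an axis\<close>

lemma continuous_on_vector_3:
  fixes f g h :: "'a::topological_space \<Rightarrow> real"
  assumes "continuous_on S f" "continuous_on S g" "continuous_on S h"
  shows "continuous_on S (\<lambda>x. vector [f x, g x, h x] :: real^3)"
proof -
  have "(vector [a, b, c] :: real^3) = a *\<^sub>R axis 1 1 + b *\<^sub>R axis 2 1 + c *\<^sub>R axis 3 1" for a b c :: real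
    by (simp add: vec_eq_iff forall_3 axis_def)
  then show ?thesis using assms by (auto intro!: continuous_intros)
qed

lemma prod_Basis_vec:
  fixes f :: "real^'n::finite \<Rightarrow> 'a::comm_monoid_mult"
  shows "(\<Prod>b\<in>Basis. f b) = (\<Prod>i\<in>UNIV. f (axis i 1))"
proof -
  have Basis: "(Basis :: (real^'n) set) = range (\<lambda>i. axis i 1)"
    by (auto simp: Basis_vec_def)
  have "inj (\<lambda>i. axis i 1 :: real^'n)"
    by (simp add: inj_def axis_eq_axis)
  then show ?thesis
    by (subst Basis, subst prod.reindex) simp_all
qed

text \<open>Lebesgue measure is determined by its values on boxes, and the preimage of a box is a
  planar box times an interval, so the volumes multiply.\<close>

lemma lborel_vec3_eq:
  "(lborel :: (real^3) measure) =
     distr lborel borel (\<lambda>p::(real^2) \<times> real. vector [fst p $ 1, fst p $ 2, snd p])"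
    (is "_ = distr lborel borel ?F")
proof (rule lborel_eqI)
  have "continuous_on UNIV ?F"
    by (intro continuous_on_vector_3 continuous_intros)
  then have F[measurable]: "?F \<in> borel_measurable borel"
    by (rule borel_measurable_continuous_onI)
  fix l u :: "real^3"
  assume lu: "\<And>b. b \<in> Basis \<Longrightarrow> l \<bullet> b \<le> u \<bullet> b"
  have le: "l $ i \<le> u $ i" for i
    using lu[of "axis i 1"] by (simp add: inner_axis axis_in_Basis_iff)
  let ?l = "vector [l $ 1, l $ 2] :: real^2" and ?u = "vector [u $ 1, u $ 2] :: real^2"
  have "?F -` box l u = box ?l ?u \<times> box (l $ 3) (u $ 3)"
    by (auto simp: mem_box_cart forall_2 forall_3 box_real)
  then have "emeasure (distr lborel borel ?F) (box l u) =
      emeasure (lborel \<Otimes>\<^sub>M lborel) (box ?l ?u \<times> box (l $ 3) (u $ 3))"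
    by (simp add: emeasure_distr lborel_prod)
  also have "\<dots> = emeasure lborel (box ?l ?u) * emeasure lborel (box (l $ 3) (u $ 3))"
    by (simp add: lborel.emeasure_pair_measure_Times)
  also have "emeasure lborel (box ?l ?u) = ennreal ((u $ 1 - l $ 1) * (u $ 2 - l $ 2))"
  proof (subst emeasure_lborel_box)
    show "?l \<bullet> b \<le> ?u \<bullet> b" if "b \<in> Basis" for b
      using that le by (auto simp: Basis_vec_def UNIV_2 inner_axis)
  qed (simp add: prod_Basis_vec UNIV_2 inner_axis mult.commute)
  also have "emeasure lborel (box (l $ 3) (u $ 3)) = ennreal (u $ 3 - l $ 3)"
    using le by (simp add: box_real)
  also have "ennreal ((u $ 1 - l $ 1) * (u $ 2 - l $ 2)) * ennreal (u $ 3 - l $ 3) =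
      ennreal ((u $ 1 - l $ 1) * (u $ 2 - l $ 2) * (u $ 3 - l $ 3))"
    using le[of 1] le[of 2] le[of 3] by (intro ennreal_mult[symmetric] mult_nonneg_nonneg) simp_all
  also have "(u $ 1 - l $ 1) * (u $ 2 - l $ 2) * (u $ 3 - l $ 3) = (\<Prod>b\<in>Basis. (u - l) \<bullet> b)"
    unfolding prod_Basis_vec UNIV_3 inner_axis by (simp add: mult.assoc)
  finally show "emeasure (distr lborel borel ?F) (box l u) = ennreal (\<Prod>b\<in>Basis. (u - l) \<bullet> b)" .
qed simp

text \<open>By Tonelli the third velocity component is integrated last. For each fixed value of it
  the inner integral is over the plane, where \<open>nn_integral_norm_sq_half_mono\<close> applies
  with dimension 2.\<close>

lemma nn_integral_cylinder_mono:
  fixes h :: "real \<times> real \<Rightarrow> ennreal"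
  assumes h[measurable]: "h \<in> borel_measurable borel" and "b \<le> c"
  shows "(\<integral>\<^sup>+(v::real^3). h (((v $ 1)\<^sup>2 + (v $ 2)\<^sup>2) / 2 - b, v $ 3) \<partial>lborel)
       \<le> (\<integral>\<^sup>+(v::real^3). h (((v $ 1)\<^sup>2 + (v $ 2)\<^sup>2) / 2 - c, v $ 3) \<partial>lborel)"
proof -
  have eq: "(\<integral>\<^sup>+(v::real^3). h (((v $ 1)\<^sup>2 + (v $ 2)\<^sup>2) / 2 - b, v $ 3) \<partial>lborel) =
      (\<integral>\<^sup>+s. \<integral>\<^sup>+(v::real^2). h ((norm v)\<^sup>2 / 2 - b, s) \<partial>lborel \<partial>lborel)" for b
  proof -
    have "continuous_on UNIV (\<lambda>p::(real^2) \<times> real. vector [fst p $ 1, fst p $ 2, snd p] :: real^3)"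
      by (intro continuous_on_vector_3 continuous_intros)
    note [measurable] = borel_measurable_continuous_onI[OF this]
    have "continuous_on UNIV (\<lambda>v::real^3. (((v $ 1)\<^sup>2 + (v $ 2)\<^sup>2) / 2 - b, v $ 3))"
      by (intro continuous_intros) auto
    note [measurable] = borel_measurable_continuous_onI[OF this]
    have "continuous_on UNIV (\<lambda>p::(real^2) \<times> real. ((norm (fst p))\<^sup>2 / 2 - b, snd p))"
      by (intro continuous_intros) auto
    note [measurable] = borel_measurable_continuous_onI[OF this]
    have "(\<integral>\<^sup>+(v::real^3). h (((v $ 1)\<^sup>2 + (v $ 2)\<^sup>2) / 2 - b, v $ 3) \<partial>lborel) =
        (\<integral>\<^sup>+(p::(real^2) \<times> real). h ((norm (fst p))\<^sup>2 / 2 - b, snd p) \<partial>lborel)"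
      unfolding lborel_vec3_eq
      by (subst nn_integral_distr) (simp_all add: norm_vec_def L2_set_def sum_2)
    also have "\<dots> = (\<integral>\<^sup>+s. \<integral>\<^sup>+(v::real^2). h ((norm v)\<^sup>2 / 2 - b, s) \<partial>lborel \<partial>lborel)"
      using lborel_pair.nn_integral_snd[of "\<lambda>p::(real^2) \<times> real. h ((norm (fst p))\<^sup>2 / 2 - b, snd p)"]
      by (simp add: lborel_prod)
    finally show ?thesis .
  qed
  have "(\<lambda>r. h (r, s)) \<in> borel_measurable borel" for s
    by (intro measurable_compose[OF _ h] borel_measurable_continuous_onI continuous_intros)
  then show ?thesis
    unfolding eq using \<open>b \<le> c\<close>
    by (intro nn_integral_mono nn_integral_norm_sq_half_mono) simp_all
qed

section \<open>From the Poisson equation to the three cases\<close>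

text \<open>The Laplacian of \<open>\<phi>\<close> is the charge minus 1, so \<open>mono\<close>
  supplies the monotonicity that the maximum principle asks for. Nonnegativity and integrability of
  \<open>f x\<close> translate between extended and Bochner integrals.\<close>

lemma steady_vlasov_poisson_field_eq_0:
  fixes T :: "real^'n::finite"
  assumes sol: "steady_vlasov_poisson T f E \<phi>" and pos: "\<And>i. T $ i > 0"
    and nonneg: "\<And>x v. f x v \<ge> 0"
    and mono: "\<And>x y. \<phi> x < \<phi> y \<Longrightarrow>
      (\<integral>\<^sup>+v. ennreal (f x v) \<partial>lborel) \<le> (\<integral>\<^sup>+v. ennreal (f y v) \<partial>lborel)"
  shows "E x = 0"
proof -
  have per: "box_periodic T \<phi>" and diff: "twice_differentiable \<phi>"
    and int: "\<And>x. integrable lborel (f x)"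
    and E: "\<And>x. E x = - gradient \<phi> x"
    and poisson: "\<And>x. - laplacian \<phi> x = - integral\<^sup>L lborel (f x) + 1"
    using sol unfolding steady_vlasov_poisson_def vlasov_poisson_def by blast+
  have "laplacian \<phi> x \<le> laplacian \<phi> y" if "\<phi> x < \<phi> y" for x y
  proof -
    have "(\<integral>\<^sup>+v. ennreal (f x v) \<partial>lborel) = ennreal (integral\<^sup>L lborel (f x))" for x
      by (rule nn_integral_eq_integral[OF int]) (simp add: nonneg)
    \<comment> \<open>This permits stripping \<open>ennreal\<close> from the inequality, since
      \<open>ennreal\<close> sends negative reals to 0.\<close>
    moreover have "integral\<^sup>L lborel (f y) \<ge> 0"
      by (rule integral_nonneg_AE) (simp add: nonneg)
    ultimately have "integral\<^sup>L lborel (f x) \<le> integral\<^sup>L lborel (f y)"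
      using mono[OF that] by (simp add: ennreal_le_iff)
    then show ?thesis
      using poisson[of x] poisson[of y] by linarith
  qed
  then have "gradient \<phi> x = 0"
    by (rule box_periodic_laplacian_mono_imp_gradient_0[OF per pos diff])
  then show ?thesis
    by (simp add: E)
qed

theorem proposition2p1:
  shows
    "(\<forall>(T :: real^2) (\<mu> :: real \<Rightarrow> real) (\<beta> :: real^2 \<Rightarrow> real)
        (f\<^sub>0 :: real^2 \<Rightarrow> real^2 \<Rightarrow> real) (E\<^sub>0 :: real^2 \<Rightarrow> real^2).
        (\<forall>i. T $ i > 0) \<longrightarrow>
        \<mu> C1_differentiable_on UNIV \<longrightarrow>
        set_integrable lborel {0..} \<mu> \<longrightarrow>
        (\<forall>r. \<mu> r \<ge> 0) \<longrightarrow>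
        f\<^sub>0 = (\<lambda>x v. \<mu> ((norm v)\<^sup>2 / 2 - \<beta> x)) \<longrightarrow>
        E\<^sub>0 = (\<lambda>x. - gradient \<beta> x) \<longrightarrow>
        steady_vlasov_poisson T f\<^sub>0 E\<^sub>0 \<beta> \<longrightarrow>
        (\<forall>x. E\<^sub>0 x = 0))
     \<and>
     (\<forall>(T :: real^3) (\<mu> :: real \<times> real \<Rightarrow> real) (\<beta> :: real^2 \<Rightarrow> real)
        (f\<^sub>0 :: real^3 \<Rightarrow> real^3 \<Rightarrow> real) (E\<^sub>0 :: real^3 \<Rightarrow> real^3).
        (\<forall>i. T $ i > 0) \<longrightarrow>
        C1_on_plane \<mu> \<longrightarrow>
        set_integrable lborel ({0..} \<times> UNIV) \<mu> \<longrightarrow>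
        (\<forall>p. \<mu> p \<ge> 0) \<longrightarrow>
        f\<^sub>0 = (\<lambda>x v. \<mu> (((v $ 1)\<^sup>2 + (v $ 2)\<^sup>2) / 2 - \<beta> (vector [x $ 1, x $ 2]), v $ 3)) \<longrightarrow>
        E\<^sub>0 = (\<lambda>x. vector [- partial_deriv 1 \<beta> (vector [x $ 1, x $ 2]),
                           - partial_deriv 2 \<beta> (vector [x $ 1, x $ 2]), 0]) \<longrightarrow>
        steady_vlasov_poisson T f\<^sub>0 E\<^sub>0 (\<lambda>x. \<beta> (vector [x $ 1, x $ 2])) \<longrightarrow>
        (\<forall>x. E\<^sub>0 x = 0))
     \<and>
     (\<forall>(T :: real^3) (\<mu> :: real \<Rightarrow> real) (\<beta> :: real^3 \<Rightarrow> real)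
        (f\<^sub>0 :: real^3 \<Rightarrow> real^3 \<Rightarrow> real) (E\<^sub>0 :: real^3 \<Rightarrow> real^3).
        (\<forall>i. T $ i > 0) \<longrightarrow>
        \<mu> C1_differentiable_on UNIV \<longrightarrow>
        (\<forall>r. \<mu> r \<ge> 0) \<longrightarrow>
        set_integrable lborel {0..} (\<lambda>r. \<mu> r * sqrt r) \<longrightarrow>
        f\<^sub>0 = (\<lambda>x v. \<mu> ((norm v)\<^sup>2 / 2 - \<beta> x)) \<longrightarrow>
        E\<^sub>0 = (\<lambda>x. - gradient \<beta> x) \<longrightarrow>
        steady_vlasov_poisson T f\<^sub>0 E\<^sub>0 \<beta> \<longrightarrow>
        (\<forall>x. E\<^sub>0 x = 0))"
proof (intro conjI allI impI)
  fix T :: "real^2" and \<mu> :: "real \<Rightarrow> real" and \<beta> :: "real^2 \<Rightarrow> real"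
    and f\<^sub>0 :: "real^2 \<Rightarrow> real^2 \<Rightarrow> real" and E\<^sub>0 :: "real^2 \<Rightarrow> real^2" and x
  assume pos: "\<forall>i. T $ i > 0" and \<mu>: "\<mu> C1_differentiable_on UNIV" "\<forall>r. \<mu> r \<ge> 0"
    and f: "f\<^sub>0 = (\<lambda>x v. \<mu> ((norm v)\<^sup>2 / 2 - \<beta> x))"
    and sol: "steady_vlasov_poisson T f\<^sub>0 E\<^sub>0 \<beta>"
  show "E\<^sub>0 x = 0"
  \<comment> \<open>In the plane the energy density is the constant \<open>2 * pi\<close> on
    nonnegative energies: raising \<open>\<beta>\<close> only extends the range over which
    \<open>\<mu>\<close> is integrated.\<close>
  proof (rule steady_vlasov_poisson_field_eq_0[OF sol])
    show "(\<integral>\<^sup>+v. ennreal (f\<^sub>0 x v) \<partial>lborel) \<le> (\<integral>\<^sup>+v. ennreal (f\<^sub>0 y v) \<partial>lborel)"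
      if "\<beta> x < \<beta> y" for x y
      unfolding f using that C1_differentiable_imp_continuous_on[OF \<mu>(1)]
      by (intro nn_integral_norm_sq_half_mono[where h = "\<lambda>r. ennreal (\<mu> r)"]
          measurable_compose[OF borel_measurable_continuous_onI measurable_ennreal]) simp_all
  qed (use pos \<mu>(2) in \<open>auto simp: f\<close>)
next
  fix T :: "real^3" and \<mu> :: "real \<times> real \<Rightarrow> real" and \<beta> :: "real^2 \<Rightarrow> real"
    and f\<^sub>0 :: "real^3 \<Rightarrow> real^3 \<Rightarrow> real" and E\<^sub>0 :: "real^3 \<Rightarrow> real^3" and x
  assume pos: "\<forall>i. T $ i > 0" and \<mu>: "C1_on_plane \<mu>" "\<forall>p. \<mu> p \<ge> 0"
    and f: "f\<^sub>0 = (\<lambda>x v. \<mu> (((v $ 1)\<^sup>2 + (v $ 2)\<^sup>2) / 2 - \<beta> (vector [x $ 1, x $ 2]), v $ 3))"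
    and sol: "steady_vlasov_poisson T f\<^sub>0 E\<^sub>0 (\<lambda>x. \<beta> (vector [x $ 1, x $ 2]))"
  have cont: "continuous_on UNIV \<mu>"
    using \<mu>(1) unfolding C1_on_plane_def gderiv_def
    by (meson continuous_at_imp_continuous_on has_derivative_continuous)
  show "E\<^sub>0 x = 0"
  \<comment> \<open>The potential is taken as a function on three-dimensional space, constant in the
    third coordinate; \<open>sol\<close> identifies the field with minus its gradient.\<close>
  proof (rule steady_vlasov_poisson_field_eq_0[OF sol])
    show "(\<integral>\<^sup>+v. ennreal (f\<^sub>0 x v) \<partial>lborel) \<le> (\<integral>\<^sup>+v. ennreal (f\<^sub>0 y v) \<partial>lborel)"
      if "\<beta> (vector [x $ 1, x $ 2]) < \<beta> (vector [y $ 1, y $ 2])" for x y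
      unfolding f using that cont
      by (intro nn_integral_cylinder_mono[where h = "\<lambda>p. ennreal (\<mu> p)"]
          measurable_compose[OF borel_measurable_continuous_onI measurable_ennreal]) simp_all
  qed (use pos \<mu>(2) in \<open>auto simp: f\<close>)
next
  fix T :: "real^3" and \<mu> :: "real \<Rightarrow> real" and \<beta> :: "real^3 \<Rightarrow> real"
    and f\<^sub>0 :: "real^3 \<Rightarrow> real^3 \<Rightarrow> real" and E\<^sub>0 :: "real^3 \<Rightarrow> real^3" and x
  assume pos: "\<forall>i. T $ i > 0" and \<mu>: "\<mu> C1_differentiable_on UNIV" "\<forall>r. \<mu> r \<ge> 0"
    and f: "f\<^sub>0 = (\<lambda>x v. \<mu> ((norm v)\<^sup>2 / 2 - \<beta> x))"
    and sol: "steady_vlasov_poisson T f\<^sub>0 E\<^sub>0 \<beta>"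
  show "E\<^sub>0 x = 0"
  \<comment> \<open>In three dimensions the energy density is a multiple of the square root, so
    raising \<open>\<beta>\<close> also increases the weight.\<close>
  proof (rule steady_vlasov_poisson_field_eq_0[OF sol])
    show "(\<integral>\<^sup>+v. ennreal (f\<^sub>0 x v) \<partial>lborel) \<le> (\<integral>\<^sup>+v. ennreal (f\<^sub>0 y v) \<partial>lborel)"
      if "\<beta> x < \<beta> y" for x y
      unfolding f using that C1_differentiable_imp_continuous_on[OF \<mu>(1)]
      by (intro nn_integral_norm_sq_half_mono[where h = "\<lambda>r. ennreal (\<mu> r)"]
          measurable_compose[OF borel_measurable_continuous_onI measurable_ennreal]) simp_all
  qed (use pos \<mu>(2) in \<open>auto simp: f\<close>)
qed

end
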